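(* In the $(n+1)$-th iteration of the ADMM procedure described in the context, with the iterates $\bar{\boldsymbol{\theta}}^{(n+1)},\boldsymbol{\mu}_0^{(n)}\in\mathbb{C}^{I_R+1}$ given, the auxiliary variable $\mathbf{x}_0$ is updated through the (non-convex) problem $$\{\mathbf{x}_0^{(n+1)}\}=\mathop{\rm argmin}_{\mathbf{x}_0}\ \rho\,\bigl\|\mathbf{x}_0-\bar{\boldsymbol{\theta}}^{(n+1)}+\boldsymbol{\mu}_0^{(n)}\bigr\|^2\quad\text{s.t.}\quad \frac{\alpha L}{\sigma^2}\bigl|\mathbf{b}^H\mathbf{x}_0\bigr|^2\ge\gamma_B ,$$ where $\mathbf{b}=\begin{bmatrix}\mathbf{a}\\0\end{bmatrix}$ and $\mathbf{a}=\mathrm{diag}(\mathbf{h}_r^H)\mathbf{G}\mathbf{w}$. An optimal solution $\mathbf{x}_0^{(n+1)}$ of this problem is given in closed form by $$\mathbf{x}_0^{(n+1)}=\begin{cases}\mathbf{x}_{0,[1]}^{(n+1)}, & \text{if } \alpha L\,\bigl|\mathbf{b}^H(\bar{\boldsymbol{\theta}}^{(n+1)}-\boldsymbol{\mu}_0^{(n)})\bigr|^2/\sigma^2\ge\gamma_B,\\ \mathbf{x}_{0,[2]}^{(n+1)}, & \text{else if } \mathbf{b}^H(\bar{\boldsymbol{\theta}}^{(n+1)}-\boldsymbol{\mu}_0^{(n)})=0,\\ \mathbf{x}_{0,[3]}^{(n+1)}, & \text{otherwise,}\end{cases}$$ where $$\mathbf{x}_{0,[1]}^{(n+1)}=\bar{\boldsymbol{\theta}}^{(n+1)}-\boldsymbol{\mu}_0^{(n)},\qquad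 \mathbf{x}_{0,[2]}^{(n+1)}=\mathbf{x}_{0,[1]}^{(n+1)}+\sqrt{\frac{\sigma^2\gamma_B}{\alpha L}}\;\frac{\mathbf{b}}{\|\mathbf{b}\|^2},$$ $$\mathbf{x}_{0,[3]}^{(n+1)}=\mathbf{x}_{0,[1]}^{(n+1)}+\left(\sqrt{\frac{\sigma^2\gamma_B}{\alpha L}}-\bigl|\mathbf{b}^H\mathbf{x}_{0,[1]}^{(n+1)}\bigr|\right)\frac{\mathbf{b}\,\mathbf{b}^H\mathbf{x}_{0,[1]}^{(n+1)}}{\|\mathbf{b}\|^2\,\bigl|\mathbf{b}^H\mathbf{x}_{0,[1]}^{(n+1)}\bigr|}.$$
   Context: Notation: $(\cdot)^H$ is conjugate transpose, $\|\cdot\|$ the Euclidean norm, $\mathrm{diag}(\cdot)$ builds a diagonal matrix from the entries of a vector, and $\mathrm{tr}$ is the trace. Setting: an active transmitter with $N$ antennas, a reconfigurable intelligent surface (RIS) with $I_R$ elements indexed by $\mathcal{I}=\{1,\dots,I_R\}$, and a single-antenna receiver. $\mathbf{h}_d\in\mathbb{C}^{N\times1}$, $\mathbf{h}_r\in\mathbb{C}^{I_R\times1}$ and $\mathbf{G}\in\mathbb{C}^{I_R\times N}$ are the channels from transmitter to receiver, from RIS to receiver and from transmitter to RIS, respectively. $\mathbf{w}\in\mathbb{C}^{N\times1}$ is the transmit beamforming vector, held fixed here. $\alpha$ is the reflection efficiency, $\sigma^2$ the noise variance, $L\gg1$ the number of active-transmission symbol periods covered by one backscatter symbol period, and $\gamma_A,\gamma_B$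 the signal-to-noise-ratio requirements of the active and backscatter transmissions. $\mathbf{S}=\mathrm{diag}(s_1,\dots,s_{I_R})$ with $s_i\in\{0,1\}$ assigns the mode of each RIS element ($1$ for reflecting, $0$ for energy harvesting). The RIS power consumption is $E_{\rm RIS}(\mathbf{w},\mathbf{S})=\mathrm{tr}(\mathbf{S})u-\eta\,\mathrm{tr}\bigl((\mathbf{I}-\mathbf{S})\mathbf{G}\mathbf{w}\mathbf{w}^H\mathbf{G}^H(\mathbf{I}-\mathbf{S})\bigr)$, where $u$ is the power consumed in controlling the phase shift of one reflecting element and $\eta$ is the energy harvesting efficiency. Optimization problem to which ADMM is applied: minimize $E_{\rm RIS}(\mathbf{w},\mathbf{S})$ over $\mathbf{S}$ and $\bar{\boldsymbol{\theta}},\mathbf{x}_0,\mathbf{x}_1,\mathbf{x}_2\in\mathbb{C}^{I_R+1}$, subject to (i) $s_i\in\{0,1\}$ and $|\bar\theta_i|^2=s_i$ for all $i\in\mathcal{I}$, and $|\bar\theta_{I_R+1}|^2=1$, where $\bar\theta_i$ is the $i$-th element of $\bar{\boldsymbol{\theta}}$; (ii) $\frac{1}{\sigma^2}|\mathbf{c}_1^H\mathbf{x}_1|^2\ge\gamma_A$, $\frac{1}{\sigma^2}|\mathbf{c}_2^H\mathbf{x}_2|^2\ge\gamma_A$, $\frac{\alpha L}{\sigma^2}|\mathbf{b}^H\mathbf{x}_0|^2\ge\gamma_B$; (iii) $\bar{\boldsymbol{\theta}}=\mathbf{x}_0=\mathbf{x}_1=\mathbf{x}_2$. Here $\mathbf{c}_1=\begin{bmatrix}\sqrt{\alpha}\,\mathbf{a}\\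 \mathbf{h}_d^H\mathbf{w}\end{bmatrix}$ and $\mathbf{c}_2=\begin{bmatrix}-\sqrt{\alpha}\,\mathbf{a}\\ \mathbf{h}_d^H\mathbf{w}\end{bmatrix}$, with $\mathbf{a},\mathbf{b}$ as in the claim. ADMM procedure: the augmented Lagrangian function is $L_g=E_{\rm RIS}(\mathbf{w},\mathbf{S})+\rho\sum_{m=0}^{2}\|\mathbf{x}_m-\bar{\boldsymbol{\theta}}+\boldsymbol{\mu}_m\|^2$, where $\rho$ is the penalty parameter and $\boldsymbol{\mu}_0,\boldsymbol{\mu}_1,\boldsymbol{\mu}_2$ are the dual variables associated with $\mathbf{x}_0,\mathbf{x}_1,\mathbf{x}_2$. Iteration $n+1$ consists of: (a) $\{\mathbf{S}^{(n+1)},\bar{\boldsymbol{\theta}}^{(n+1)}\}$ is obtained by minimizing $L_g$ over $\mathbf{S},\bar{\boldsymbol{\theta}}$ subject to (i), with $\mathbf{x}_m=\mathbf{x}_m^{(n)}$ and $\boldsymbol{\mu}_m=\boldsymbol{\mu}_m^{(n)}$; (b) $\mathbf{x}_0^{(n+1)},\mathbf{x}_1^{(n+1)},\mathbf{x}_2^{(n+1)}$ are obtained by minimizing $L_g$ over $\mathbf{x}_0,\mathbf{x}_1,\mathbf{x}_2$ subject to (ii), with $\mathbf{S}=\mathbf{S}^{(n+1)}$, $\bar{\boldsymbol{\theta}}=\bar{\boldsymbol{\theta}}^{(n+1)}$ and $\boldsymbol{\mu}_m=\boldsymbol{\mu}_m^{(n)}$, which decomposes into one independent subproblem per $\mathbf{x}_m$,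 the one for $\mathbf{x}_0$ being the problem in the claim; (c) $\boldsymbol{\mu}_m^{(n+1)}=\boldsymbol{\mu}_m^{(n)}+\mathbf{x}_m^{(n+1)}-\bar{\boldsymbol{\theta}}^{(n+1)}$, $m=0,1,2$. The procedure is run inside an outer block coordinate descent loop that alternates between updating $\mathbf{w}$ and running ADMM. In the first outer iteration ADMM is initialized by $\mathbf{x}_m^{(0)}=\mathbf{1}$, $\boldsymbol{\mu}_m^{(0)}=\mathbf{0}$, and in later ones by the final values of $\mathbf{x}_m,\boldsymbol{\mu}_m$ from the previous ADMM run. *)

theory Defs
  imports "HOL-Analysis.Analysis"
begin

section \<open>Complex vectors and matrices\<close>

definition hdot :: "complex ^ 'k::finite \<Rightarrow> complex ^ 'k \<Rightarrow> complex" where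
  \<comment> \<open>\<open>x\<^sup>H y\<close>; the library's \<open>\<bullet>\<close> on \<open>complex ^ 'k\<close> is only its real part\<close>
  "hdot x y = (\<Sum>k\<in>UNIV. cnj (x $ k) * y $ k)"

definition conj_vec :: "complex ^ 'k::finite \<Rightarrow> complex ^ 'k" where
  "conj_vec x = (\<chi> k. cnj (x $ k))"

definition herm :: "complex ^ 'n::finite ^ 'm::finite \<Rightarrow> complex ^ 'm ^ 'n" where
  "herm A = (\<chi> i j. cnj (A $ j $ i))"

definition outer :: "complex ^ 'k::finite \<Rightarrow> complex ^ 'k \<Rightarrow> complex ^ 'k ^ 'k" where
  \<comment> \<open>\<open>x y\<^sup>H\<close>\<close>
  "outer x y = (\<chi> i j. x $ i * cnj (y $ j))"

definition diag :: "complex ^ 'k::finite \<Rightarrow> complex ^ 'k ^ 'k" where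
  "diag x = (\<chi> i j. if i = j then x $ i else 0)"

text \<open>
  RIS elements are indexed by \<open>'i\<close>, so vectors with \<open>I\<^sub>R + 1\<close> entries are indexed by
  \<open>'i option\<close>: entry \<open>Some i\<close> belongs to element \<open>i\<close>, and \<open>None\<close> is the last entry.
\<close>

definition stack :: "complex ^ 'i::finite \<Rightarrow> complex \<Rightarrow> complex ^ 'i option" where
  "stack v z = (\<chi> k. case k of Some i \<Rightarrow> v $ i | None \<Rightarrow> z)"


section \<open>System model\<close>

record ('n, 'i) ris_system =
  h_d :: "complex ^ 'n"
  h_r :: "complex ^ 'i"
  G_mat :: "complex ^ 'n ^ 'i"
  alpha :: real     \<comment> \<open>reflection efficiency\<close>
  L_sym :: nat      \<comment> \<open>active symbol periods per backscatter symbol period\<close>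
  sigma :: real     \<comment> \<open>the noise variance is \<open>sigma\<^sup>2\<close>\<close>
  gamma_A :: real
  gamma_B :: real
  u_pow :: real     \<comment> \<open>phase-control power of one reflecting element\<close>
  eta :: real       \<comment> \<open>energy harvesting efficiency\<close>
  rho :: real       \<comment> \<open>ADMM penalty parameter\<close>

definition a_vec :: "('n::finite, 'i::finite) ris_system \<Rightarrow> complex ^ 'n \<Rightarrow> complex ^ 'i" where
  "a_vec P w = (diag (conj_vec (h_r P)) ** G_mat P) *v w"

definition b_vec :: "('n::finite, 'i::finite) ris_system \<Rightarrow> complex ^ 'n \<Rightarrow> complex ^ 'i option" where
  "b_vec P w = stack (a_vec P w) 0"

definition c1_vec :: "('n::finite, 'i::finite) ris_system \<Rightarrow> complex ^ 'n \<Rightarrow> complex ^ 'i option" where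
  "c1_vec P w = stack (sqrt (alpha P) *\<^sub>R a_vec P w) (hdot (h_d P) w)"

definition c2_vec :: "('n::finite, 'i::finite) ris_system \<Rightarrow> complex ^ 'n \<Rightarrow> complex ^ 'i option" where
  "c2_vec P w = stack (- sqrt (alpha P) *\<^sub>R a_vec P w) (hdot (h_d P) w)"

definition E_RIS ::
  "('n::finite, 'i::finite) ris_system \<Rightarrow> complex ^ 'n \<Rightarrow> complex ^ 'i ^ 'i \<Rightarrow> real" where
  \<comment> \<open>both traces are real for the matrices \<open>S\<close> admitted below; \<open>Re\<close> only converts the type\<close>
  "E_RIS P w S =
     Re (trace S) * u_pow P
     - eta P * Re (trace ((mat 1 - S) ** G_mat P ** outer w w ** herm (G_mat P) ** (mat 1 - S)))"

definition mode_constraint :: "complex ^ 'i::finite ^ 'i \<Rightarrow> complex ^ 'i option \<Rightarrow> bool" where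
  "mode_constraint S \<theta> \<longleftrightarrow>
     (\<exists>s :: real ^ 'i. S = diag (\<chi> i. complex_of_real (s $ i)) \<and>
        (\<forall>i. s $ i \<in> {0, 1} \<and> (cmod (\<theta> $ Some i))\<^sup>2 = s $ i)) \<and>
     (cmod (\<theta> $ None))\<^sup>2 = 1"

definition backscatter_constraint ::
  "('n::finite, 'i::finite) ris_system \<Rightarrow> complex ^ 'n \<Rightarrow> complex ^ 'i option \<Rightarrow> bool" where
  "backscatter_constraint P w x\<^sub>0 \<longleftrightarrow>
     alpha P * real (L_sym P) / (sigma P)\<^sup>2 * (cmod (hdot (b_vec P w) x\<^sub>0))\<^sup>2 \<ge> gamma_B P"

text \<open>
  The three auxiliary (respectively dual) vectors form a family indexed by the three-element
  type \<open>3\<close>, whose elements are \<open>0\<close>, \<open>1\<close>, \<open>2\<close>.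
\<close>

definition snr_constraints ::
  "('n::finite, 'i::finite) ris_system \<Rightarrow> complex ^ 'n \<Rightarrow> (3 \<Rightarrow> complex ^ 'i option) \<Rightarrow> bool" where
  "snr_constraints P w x \<longleftrightarrow>
     1 / (sigma P)\<^sup>2 * (cmod (hdot (c1_vec P w) (x 1)))\<^sup>2 \<ge> gamma_A P \<and>
     1 / (sigma P)\<^sup>2 * (cmod (hdot (c2_vec P w) (x 2)))\<^sup>2 \<ge> gamma_A P \<and>
     backscatter_constraint P w (x 0)"


section \<open>ADMM\<close>

definition aug_lagrangian ::
  "('n::finite, 'i::finite) ris_system \<Rightarrow> complex ^ 'n \<Rightarrow> complex ^ 'i ^ 'i \<Rightarrow>
   complex ^ 'i option \<Rightarrow> (3 \<Rightarrow> complex ^ 'i option) \<Rightarrow> (3 \<Rightarrow> complex ^ 'i option) \<Rightarrow> real" where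
  "aug_lagrangian P w S \<theta> x \<mu> =
     E_RIS P w S + rho P * (\<Sum>m\<in>UNIV. (norm (x m - \<theta> + \<mu> m))\<^sup>2)"

definition admm_step_a ::
  "('n::finite, 'i::finite) ris_system \<Rightarrow> complex ^ 'n \<Rightarrow>
   (3 \<Rightarrow> complex ^ 'i option) \<Rightarrow> (3 \<Rightarrow> complex ^ 'i option) \<Rightarrow>
   complex ^ 'i ^ 'i \<Rightarrow> complex ^ 'i option \<Rightarrow> bool" where
  "admm_step_a P w x \<mu> S' \<theta>' \<longleftrightarrow>
     is_arg_min (\<lambda>(S, \<theta>). aug_lagrangian P w S \<theta> x \<mu>)
       (\<lambda>(S, \<theta>). mode_constraint S \<theta>) (S', \<theta>')"

definition admm_step_b ::
  "('n::finite, 'i::finite) ris_system \<Rightarrow> complex ^ 'n \<Rightarrow>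
   complex ^ 'i ^ 'i \<Rightarrow> complex ^ 'i option \<Rightarrow>
   (3 \<Rightarrow> complex ^ 'i option) \<Rightarrow> (3 \<Rightarrow> complex ^ 'i option) \<Rightarrow> bool" where
  "admm_step_b P w S' \<theta>' \<mu> x' \<longleftrightarrow>
     is_arg_min (\<lambda>x. aug_lagrangian P w S' \<theta>' x \<mu>) (snr_constraints P w) x'"

text \<open>
  \<open>admm_state P w n x \<mu>\<close>: with transmit beamformer \<open>w\<close>, the ADMM procedure can have
  \<open>x\<^sub>m\<^sup>(\<^sup>n\<^sup>) = x m\<close> and \<open>\<mu>\<^sub>m\<^sup>(\<^sup>n\<^sup>) = \<mu> m\<close> after \<open>n\<close> iterations of the current run. The rule
  \<open>outer\<close> is the passage to the next outer iteration; the rule by which the outer loop chooses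
  the new beamformer \<open>w'\<close> and its number of ADMM iterations are left arbitrary.
\<close>

inductive admm_state ::
  "('n::finite, 'i::finite) ris_system \<Rightarrow> complex ^ 'n \<Rightarrow> nat \<Rightarrow>
   (3 \<Rightarrow> complex ^ 'i option) \<Rightarrow> (3 \<Rightarrow> complex ^ 'i option) \<Rightarrow> bool"
  for P :: "('n::finite, 'i::finite) ris_system"
where
  init: "admm_state P w 0 (\<lambda>m. vec 1) (\<lambda>m. 0)"
| step: "admm_state P w n x \<mu> \<Longrightarrow> admm_step_a P w x \<mu> S' \<theta>' \<Longrightarrow> admm_step_b P w S' \<theta>' \<mu> x' \<Longrightarrow>
     admm_state P w (Suc n) x' (\<lambda>m. \<mu> m + x' m - \<theta>')"
| outer: "admm_state P w n x \<mu> \<Longrightarrow> admm_state P w' 0 x \<mu>"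


section \<open>Closed-form update of the first auxiliary vector\<close>

definition x0_1 :: "complex ^ 'i::finite option \<Rightarrow> complex ^ 'i option \<Rightarrow> complex ^ 'i option" where
  "x0_1 \<theta> \<mu>\<^sub>0 = \<theta> - \<mu>\<^sub>0"

definition x0_2 ::
  "('n::finite, 'i::finite) ris_system \<Rightarrow> complex ^ 'n \<Rightarrow>
   complex ^ 'i option \<Rightarrow> complex ^ 'i option \<Rightarrow> complex ^ 'i option" where
  "x0_2 P w \<theta> \<mu>\<^sub>0 = x0_1 \<theta> \<mu>\<^sub>0 +
     (sqrt ((sigma P)\<^sup>2 * gamma_B P / (alpha P * real (L_sym P))) / (norm (b_vec P w))\<^sup>2)
       *\<^sub>R b_vec P w"

definition x0_3 ::
  "('n::finite, 'i::finite) ris_system \<Rightarrow> complex ^ 'n \<Rightarrow>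
   complex ^ 'i option \<Rightarrow> complex ^ 'i option \<Rightarrow> complex ^ 'i option" where
  "x0_3 P w \<theta> \<mu>\<^sub>0 = x0_1 \<theta> \<mu>\<^sub>0 +
     ((sqrt ((sigma P)\<^sup>2 * gamma_B P / (alpha P * real (L_sym P)))
         - cmod (hdot (b_vec P w) (x0_1 \<theta> \<mu>\<^sub>0)))
       / ((norm (b_vec P w))\<^sup>2 * cmod (hdot (b_vec P w) (x0_1 \<theta> \<mu>\<^sub>0))))
       *\<^sub>R (outer (b_vec P w) (b_vec P w) *v x0_1 \<theta> \<mu>\<^sub>0)"

definition x0_update ::
  "('n::finite, 'i::finite) ris_system \<Rightarrow> complex ^ 'n \<Rightarrow>
   complex ^ 'i option \<Rightarrow> complex ^ 'i option \<Rightarrow> complex ^ 'i option" where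
  "x0_update P w \<theta> \<mu>\<^sub>0 =
     (if alpha P * real (L_sym P) * (cmod (hdot (b_vec P w) (\<theta> - \<mu>\<^sub>0)))\<^sup>2 / (sigma P)\<^sup>2 \<ge> gamma_B P
        then x0_1 \<theta> \<mu>\<^sub>0
      else if hdot (b_vec P w) (\<theta> - \<mu>\<^sub>0) = 0 then x0_2 P w \<theta> \<mu>\<^sub>0
      else x0_3 P w \<theta> \<mu>\<^sub>0)"

end

(* Feasibility depends on x only through the scalar b^H x and means |b^H x| >= r for
   r = sqrt (sigma^2 gamma_B / (alpha L)). If v = theta - mu_0 is infeasible, Cauchy-Schwarz gives
   norm b * norm (x - v) >= |b^H (x - v)| >= r - |b^H v|, and moving from v along b in the
   direction of the phase of b^H v (any phase if b^H v = 0) attains this bound. *)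

theory Submission
  imports Defs
begin

lemma hdot_add_right: "hdot x (y + z) = hdot x y + hdot x z"
  by (simp add: hdot_def distrib_left sum.distrib)

lemma hdot_diff_right: "hdot x (y - z) = hdot x y - hdot x z"
  by (simp add: hdot_def right_diff_distrib sum_subtractf)

lemma hdot_scaleR_right: "hdot x (r *\<^sub>R y) = r *\<^sub>R hdot x y"
  by (simp add: hdot_def scaleR_sum_right)

lemma hdot_vector_scalar_mult_right: "hdot x (c *s y) = c * hdot x y"
  by (simp add: hdot_def sum_distrib_left mult_ac)

lemma hdot_self: "hdot x x = complex_of_real ((norm x)\<^sup>2)"
proof -
  have "(norm x)\<^sup>2 = (\<Sum>k\<in>UNIV. (cmod (x $ k))\<^sup>2)"
    by (simp add: norm_vec_def L2_set_def sum_nonneg)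
  moreover have "cnj z * z = complex_of_real ((cmod z)\<^sup>2)" for z
    by (metis complex_norm_square mult.commute of_real_power)
  ultimately show ?thesis by (simp add: hdot_def)
qed

text \<open>The real inner product sees only the real part of \<open>hdot\<close>, so the modulus is
  bounded entrywise first; what remains is Cauchy-Schwarz for the real vectors of moduli.\<close>

lemma Cauchy_Schwarz_hdot: "cmod (hdot x y) \<le> norm x * norm y"
proof -
  have "cmod (hdot x y) \<le> (\<Sum>k\<in>UNIV. \<bar>cmod (x $ k)\<bar> * \<bar>cmod (y $ k)\<bar>)"
    unfolding hdot_def by (rule order_trans[OF norm_sum]) (simp add: norm_mult)
  also have "\<dots> \<le> norm x * norm y"
    unfolding norm_vec_def by (rule L2_set_mult_ineq)
  finally show ?thesis .
qed

lemma outer_mult_vec: "outer x y *v z = hdot y z *s x"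
  by (simp add: outer_def hdot_def matrix_vector_mult_def vec_eq_iff sum_distrib_left mult_ac)

lemma norm_vector_scalar_mult:
  fixes x :: "complex ^ 'k::finite"
  shows "norm (c *s x) = cmod c * norm x"
  by (simp add: norm_vec_def norm_mult L2_set_right_distrib)

text \<open>The displacement \<open>p - v\<close> is a multiple of \<open>b\<close>, the equality
  case of Cauchy-Schwarz, and \<open>e\<close> is the phase of \<open>hdot b v\<close>, so the whole
  displacement goes into raising the modulus from \<open>c\<close> to \<open>r\<close>. For
  \<open>c = 0\<close> any unit \<open>e\<close> is allowed, which lets one formula serve both
  infeasible cases of the update.\<close>

lemma
  fixes b v :: "complex ^ 'k::finite"
  assumes "b \<noteq> 0" and c: "hdot b v = of_real c * e" "0 \<le> c" "c \<le> r" and e: "cmod e = 1"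
  defines "p \<equiv> v + ((r - c) / (norm b)\<^sup>2) *\<^sub>R (e *s b)"
  shows cmod_hdot_closest: "cmod (hdot b p) = r"
    and closest_le: "r \<le> cmod (hdot b y) \<Longrightarrow> norm (p - v) \<le> norm (y - v)"
proof -
  have b: "norm b > 0" using \<open>b \<noteq> 0\<close> by simp
  have "hdot b p = of_real c * e + of_real ((r - c) / (norm b)\<^sup>2 * (norm b)\<^sup>2) * e"
    by (simp add: p_def hdot_add_right hdot_scaleR_right hdot_vector_scalar_mult_right
        hdot_self c scaleR_conv_of_real[where 'a = complex])
  also have "\<dots> = of_real r * e"
  proof -
    have "(r - c) / (norm b)\<^sup>2 * (norm b)\<^sup>2 = r - c" using b by simp
    then show ?thesis by (simp only:) (simp add: left_diff_distrib)
  qed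
  \<comment> \<open>The bounds on \<open>c\<close> give \<open>0 \<le> r\<close>, so the modulus of
    \<open>of_real r\<close> is \<open>r\<close> itself.\<close>
  finally show "cmod (hdot b p) = r"
    using c e by (simp add: norm_mult)
  assume "r \<le> cmod (hdot b y)"
  moreover have "cmod (hdot b v) = c"
    using c e by (simp add: norm_mult)
  ultimately have "r - c \<le> cmod (hdot b (y - v))"
    using norm_triangle_ineq2[of "hdot b y" "hdot b v"] by (simp add: hdot_diff_right)
  also have "\<dots> \<le> norm b * norm (y - v)"
    by (rule Cauchy_Schwarz_hdot)
  finally have "(r - c) / norm b \<le> norm (y - v)"
    using b by (simp add: pos_divide_le_eq mult.commute)
  \<comment> \<open>As \<open>e\<close> is a unit and \<open>c \<le> r\<close>, the displacement has
    exactly the length of the lower bound just found for \<open>y\<close>.\<close>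
  moreover have "norm (p - v) = (r - c) / norm b"
    using b c e by (simp add: p_def norm_vector_scalar_mult power2_eq_square)
  ultimately show "norm (p - v) \<le> norm (y - v)" by simp
qed

text \<open>Clear the positive factors and take roots. \<open>sqrt\<close> is increasing on all
  reals and negative at negative arguments, so this is an equivalence whatever the sign of
  \<open>gamma_B P\<close>.\<close>

lemma backscatter_constraint_iff:
  assumes "alpha P > 0" "L_sym P \<ge> 1" "sigma P > 0"
  shows "backscatter_constraint P w y \<longleftrightarrow>
    sqrt ((sigma P)\<^sup>2 * gamma_B P / (alpha P * real (L_sym P))) \<le> cmod (hdot (b_vec P w) y)"
proof -
  have "alpha P * real (L_sym P) > 0" "(sigma P)\<^sup>2 > 0"
    using assms by auto
  then have "backscatter_constraint P w y \<longleftrightarrow>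
      (sigma P)\<^sup>2 * gamma_B P / (alpha P * real (L_sym P)) \<le> (cmod (hdot (b_vec P w) y))\<^sup>2"
    by (simp add: backscatter_constraint_def pos_divide_le_eq pos_le_divide_eq mult_ac)
  also have "\<dots> \<longleftrightarrow>
      sqrt ((sigma P)\<^sup>2 * gamma_B P / (alpha P * real (L_sym P))) \<le> cmod (hdot (b_vec P w) y)"
    using real_sqrt_le_iff[of _ "(cmod (hdot (b_vec P w) y))\<^sup>2"] by simp
  finally show ?thesis .
qed

lemma x0_update_closest:
  fixes P :: "('n::finite, 'i::finite) ris_system"
  assumes P: "alpha P > 0" "L_sym P \<ge> 1" "sigma P > 0"
    and feas: "\<exists>y. backscatter_constraint P w y"
  shows "backscatter_constraint P w (x0_update P w \<theta> \<mu>\<^sub>0) \<and>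
    (\<forall>y. backscatter_constraint P w y \<longrightarrow>
      norm (x0_update P w \<theta> \<mu>\<^sub>0 - (\<theta> - \<mu>\<^sub>0)) \<le> norm (y - (\<theta> - \<mu>\<^sub>0)))"
proof -
  define b where "b = b_vec P w"
  define v where "v = \<theta> - \<mu>\<^sub>0"
  define r where "r = sqrt ((sigma P)\<^sup>2 * gamma_B P / (alpha P * real (L_sym P)))"
  have iff: "backscatter_constraint P w y \<longleftrightarrow> r \<le> cmod (hdot b y)" for y
    unfolding b_def r_def by (rule backscatter_constraint_iff[OF P])
  have upd: "x0_update P w \<theta> \<mu>\<^sub>0 =
      (if backscatter_constraint P w v then v
       else if hdot b v = 0 then x0_2 P w \<theta> \<mu>\<^sub>0 else x0_3 P w \<theta> \<mu>\<^sub>0)"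
    by (simp add: x0_update_def backscatter_constraint_def b_def v_def x0_1_def)
  show ?thesis
  proof (cases "backscatter_constraint P w v")
    case True
    then show ?thesis by (simp add: upd v_def)
  next
    case False
    then have less: "cmod (hdot b v) < r" by (simp add: iff)
    \<comment> \<open>For \<open>b = 0\<close> the constraint does not depend on the point, so a
      feasible \<open>y\<close> would make \<open>v\<close> feasible too.\<close>
    have "b \<noteq> 0"
    proof
      assume "b = 0"
      then have "hdot b y = 0" for y by (simp add: hdot_def)
      with feas False show False by (simp add: iff)
    qed
    \<comment> \<open>The value 1 at \<open>hdot b v = 0\<close> selects the direction
      \<open>b\<close> itself, as \<open>x0_2\<close> does.\<close>
    define e where "e = (if hdot b v = 0 then 1 else hdot b v / of_real (cmod (hdot b v)))"
    have e: "cmod e = 1" "hdot b v = of_real (cmod (hdot b v)) * e"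
      by (auto simp: e_def norm_divide)
    have "x0_update P w \<theta> \<mu>\<^sub>0 = v + ((r - cmod (hdot b v)) / (norm b)\<^sup>2) *\<^sub>R (e *s b)"
    proof (cases "hdot b v = 0")
      case True
      with False show ?thesis
        by (simp add: upd x0_2_def x0_1_def e_def flip: b_def v_def r_def)
    next
      case nz: False
      \<comment> \<open>Here the phase is a quotient inside the complex scalar, while
        \<open>x0_3\<close> divides by the modulus in its real factor; this identity moves the
        division across.\<close>
      have "z *s b /\<^sub>R t = (z / of_real t) *s b" for z t
        by (simp add: vec_eq_iff scaleR_conv_of_real[where 'a = complex] divide_inverse mult_ac)
      then have "e *s b = (hdot b v *s b) /\<^sub>R cmod (hdot b v)"
        using nz by (simp add: e_def)
      moreover have "x0_update P w \<theta> \<mu>\<^sub>0 =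
          v + ((r - cmod (hdot b v)) / ((norm b)\<^sup>2 * cmod (hdot b v))) *\<^sub>R (hdot b v *s b)"
        using False nz
        by (simp add: upd x0_3_def x0_1_def outer_mult_vec flip: b_def v_def r_def)
      ultimately show ?thesis by (simp add: divide_inverse mult_ac)
    qed
    with cmod_hdot_closest[OF \<open>b \<noteq> 0\<close> e(2) _ _ e(1)] closest_le[OF \<open>b \<noteq> 0\<close> e(2) _ _ e(1)] less
    show ?thesis by (simp add: iff flip: v_def)
  qed
qed

theorem mainTheorem1:
  fixes P :: "('n::finite, 'i::finite) ris_system"
    and w :: "complex ^ 'n"
    and n :: nat
    and x \<mu> :: "3 \<Rightarrow> complex ^ 'i option"
    and S :: "complex ^ 'i ^ 'i"
    and \<theta> :: "complex ^ 'i option"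
  assumes "alpha P > 0" and "L_sym P \<ge> 1" and "sigma P > 0" and "rho P > 0"
    and "admm_state P w n x \<mu>"
    and "admm_step_a P w x \<mu> S \<theta>"
    and "\<exists>y. backscatter_constraint P w y"
  shows "is_arg_min (\<lambda>x\<^sub>0. rho P * (norm (x\<^sub>0 - \<theta> + \<mu> 0))\<^sup>2) (backscatter_constraint P w)
           (x0_update P w \<theta> (\<mu> 0))"
proof -
  \<comment> \<open>The objective becomes \<open>rho P\<close> times the squared distance to
    \<open>\<theta> - \<mu> 0\<close>; squaring norms and scaling by a positive factor preserve
    order, so a nearest feasible point is a minimizer.\<close>
  have eq: "x\<^sub>0 - \<theta> + \<mu> 0 = x\<^sub>0 - (\<theta> - \<mu> 0)" for x\<^sub>0 by simp
  show ?thesis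
    unfolding is_arg_min_linorder eq
    using x0_update_closest[OF assms(1-3,7), of \<theta> "\<mu> 0"] \<open>rho P > 0\<close>
    by (auto intro!: power_mono mult_left_mono)
qed

end
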